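(* The linear map on symmetric functions (over $\mathbb Q$) that sends $\tilde\Xi_\lambda$ to $(\operatorname{sgn}\lambda)\,\tilde m_\lambda/\ell(\lambda)!$ for every integer partition $\lambda$ is an involution.
   Context: For an integer partition $\lambda$, $\ell(\lambda)$ is the number of parts, $|\lambda|$ the sum of the parts, $\operatorname{sgn}\lambda=(-1)^{|\lambda|-\ell(\lambda)}$, and $\tilde m_\lambda=(r_1!r_2!\cdots)m_\lambda$ where $r_i$ is the number of parts of $\lambda$ equal to $i$. $D_\lambda$ is the digraph which is a disjoint union of directed paths, the $i$th having $\lambda_i$ vertices. Every subset $S$ of the edges of $D_\lambda$ gives a spanning subgraph that is a disjoint union of directed paths (isolated vertices being paths with no edges); let $\pi(S)$ be the partition of the vertex set into the vertex sets of these paths, and $\ell(\pi(S))$ their number. Define $$\tilde\Xi_\lambda=\sum_{S\subset E(D_\lambda)}\frac{\tilde m_{\pi(S)}}{\ell(\pi(S))!},$$ where a set partition in a subscript stands for the integer partition of its block sizes. The $\tilde\Xi_\lambda$ form a $\mathbb Q$-linear basis of the ring of symmetric functions (in countably many variables), so the map is well defined. *)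

theory Defs
  imports Complex_Main "HOL-Library.Multiset" "HOL-Library.Poly_Mapping"
begin

text \<open>A monomial in the variables \<open>x\<^sub>0, x\<^sub>1, \<dots>\<close> is its exponent vector, of type
  \<^typ>\<open>nat \<Rightarrow>\<^sub>0 nat\<close>. Symmetric functions are the formal power series of bounded degree,
  given by their coefficients, that are invariant under all permutations of the variables.\<close>

definition mon_degree :: "(nat \<Rightarrow>\<^sub>0 nat) \<Rightarrow> nat" where
  "mon_degree a = (\<Sum>i\<in>Poly_Mapping.keys a. Poly_Mapping.lookup a i)"

definition bounded_degree :: "((nat \<Rightarrow>\<^sub>0 nat) \<Rightarrow> rat) \<Rightarrow> bool" where
  "bounded_degree f \<longleftrightarrow> (\<exists>d. \<forall>a. f a \<noteq> 0 \<longrightarrow> mon_degree a \<le> d)"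

definition symmetric_coeffs :: "((nat \<Rightarrow>\<^sub>0 nat) \<Rightarrow> rat) \<Rightarrow> bool" where
  "symmetric_coeffs f \<longleftrightarrow> (\<forall>\<sigma>. bij \<sigma> \<longrightarrow> (\<forall>a. f (Poly_Mapping.map_key \<sigma> a) = f a))"

typedef symfun = "{f. bounded_degree f \<and> symmetric_coeffs f}"
  morphisms coeff_of Abs_symfun
  by (rule exI[of _ "\<lambda>_. 0"]) (simp add: bounded_degree_def symmetric_coeffs_def)

setup_lifting type_definition_symfun

instantiation symfun :: ab_group_add
begin

lift_definition zero_symfun :: symfun is "\<lambda>_. 0"
  by (simp add: bounded_degree_def symmetric_coeffs_def)

lift_definition plus_symfun :: "symfun \<Rightarrow> symfun \<Rightarrow> symfun" is "\<lambda>f g a. f a + g a"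
proof -
  fix f g :: "(nat \<Rightarrow>\<^sub>0 nat) \<Rightarrow> rat"
  assume f: "bounded_degree f \<and> symmetric_coeffs f" and g: "bounded_degree g \<and> symmetric_coeffs g"
  from f g obtain d e where d: "\<And>a. f a \<noteq> 0 \<Longrightarrow> mon_degree a \<le> d"
    and e: "\<And>a. g a \<noteq> 0 \<Longrightarrow> mon_degree a \<le> e"
    unfolding bounded_degree_def by auto
  have "mon_degree a \<le> max d e" if "f a + g a \<noteq> 0" for a
    using that d[of a] e[of a] by (cases "f a = 0") (auto simp: le_max_iff_disj)
  hence "bounded_degree (\<lambda>a. f a + g a)"
    unfolding bounded_degree_def by blast
  with f g show "bounded_degree (\<lambda>a. f a + g a) \<and> symmetric_coeffs (\<lambda>a. f a + g a)"
    by (simp add: symmetric_coeffs_def)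
qed

lift_definition uminus_symfun :: "symfun \<Rightarrow> symfun" is "\<lambda>f a. - f a"
  by (simp add: bounded_degree_def symmetric_coeffs_def)

definition minus_symfun :: "symfun \<Rightarrow> symfun \<Rightarrow> symfun" where
  "minus_symfun f g = f + - g"

instance
  by standard (transfer; simp add: fun_eq_iff minus_symfun_def algebra_simps)+

end

lift_definition scale_symfun :: "rat \<Rightarrow> symfun \<Rightarrow> symfun" (infixr "*\<^sub>s" 75)
  is "\<lambda>c f a. c * f a"
  by (auto simp: bounded_degree_def symmetric_coeffs_def)

interpretation symfun: vector_space scale_symfun
  by standard (transfer; simp add: fun_eq_iff algebra_simps)+

text \<open>An integer partition is the multiset of its parts.\<close>

definition int_partition :: "nat multiset \<Rightarrow> bool" where
  "int_partition p \<longleftrightarrow> 0 \<notin># p"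

text \<open>All parts are positive, so \<open>size p \<le> sum_mset p\<close> and the subtraction does not truncate.\<close>

definition sgn_part :: "nat multiset \<Rightarrow> rat" where
  "sgn_part p = (- 1) ^ (sum_mset p - size p)"

text \<open>The partition formed by the nonzero exponents of a monomial.\<close>

definition exponents :: "(nat \<Rightarrow>\<^sub>0 nat) \<Rightarrow> nat multiset" where
  "exponents a = image_mset (Poly_Mapping.lookup a) (mset_set (Poly_Mapping.keys a))"

lemma sum_mset_exponents: "sum_mset (exponents a) = mon_degree a"
  by (simp add: exponents_def mon_degree_def sum_unfold_sum_mset)

lemma exponents_map_key:
  assumes "bij \<sigma>"
  shows "exponents (Poly_Mapping.map_key \<sigma> a) = exponents a"
proof -
  have inj: "inj \<sigma>" and surj: "surj \<sigma>"
    using assms by (auto simp: bij_def)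
  have "exponents (Poly_Mapping.map_key \<sigma> a)
      = image_mset (Poly_Mapping.lookup a) (image_mset \<sigma> (mset_set (\<sigma> -` Poly_Mapping.keys a)))"
    by (simp add: exponents_def keys_map_key[OF inj] map_key.rep_eq[of \<sigma>] inj
        multiset.map_comp comp_def)
  also have "image_mset \<sigma> (mset_set (\<sigma> -` Poly_Mapping.keys a)) = mset_set (Poly_Mapping.keys a)"
    using inj surj by (subst image_mset_mset_set) (auto intro: inj_on_subset simp: surj_image_vimage_eq)
  finally show ?thesis
    by (simp add: exponents_def)
qed

text \<open>The monomial symmetric function: the sum of all distinct monomials with the given exponents.\<close>

lift_definition monomial_symfun :: "nat multiset \<Rightarrow> symfun"
  is "\<lambda>p a. if exponents a = p then 1 else 0"
  by (auto simp: bounded_degree_def symmetric_coeffs_def exponents_map_key sum_mset_exponents[symmetric])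

definition aug_monomial_symfun :: "nat multiset \<Rightarrow> symfun" where
  "aug_monomial_symfun p = (\<Prod>i\<in>set_mset p. fact (count p i)) *\<^sub>s monomial_symfun p"

text \<open>The digraph \<open>D\<^sub>p\<close>: vertex \<open>(i, j)\<close> is the \<open>j\<close>th vertex of the \<open>i\<close>th path, where the parts
  are listed in weakly decreasing order and both indices start from 0.\<close>

definition parts :: "nat multiset \<Rightarrow> nat list" where
  "parts p = rev (sorted_list_of_multiset p)"

definition path_verts :: "nat multiset \<Rightarrow> (nat \<times> nat) set" where
  "path_verts p = {(i, j). i < length (parts p) \<and> j < parts p ! i}"

definition path_edges :: "nat multiset \<Rightarrow> ((nat \<times> nat) \<times> (nat \<times> nat)) set" where
  "path_edges p = {((i, j), (i, Suc j)) |i j. i < length (parts p) \<and> Suc j < parts p ! i}"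

lemma finite_path_verts: "finite (path_verts p)"
proof -
  have "path_verts p = (SIGMA i:{..<length (parts p)}. {..<parts p ! i})"
    by (auto simp: path_verts_def)
  thus ?thesis by simp
qed

lemma finite_path_edges: "finite (path_edges p)"
proof (rule finite_subset)
  show "path_edges p \<subseteq> path_verts p \<times> path_verts p"
    by (auto simp: path_edges_def path_verts_def)
qed (simp add: finite_path_verts)

text \<open>The vertex sets of the connected components (that is, of the paths) of the spanning subgraph
  with edge set \<open>S\<close>.\<close>

definition path_blocks ::
    "nat multiset \<Rightarrow> ((nat \<times> nat) \<times> (nat \<times> nat)) set \<Rightarrow> (nat \<times> nat) set set" where
  "path_blocks p S = path_verts p // (S \<union> S\<inverse>)\<^sup>*"

definition block_sizes :: "'a set set \<Rightarrow> nat multiset" where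
  "block_sizes P = image_mset card (mset_set P)"

definition Xi_symfun :: "nat multiset \<Rightarrow> symfun" where
  "Xi_symfun p = (\<Sum>S\<in>Pow (path_edges p).
     (1 / fact (card (path_blocks p S))) *\<^sub>s aug_monomial_symfun (block_sizes (path_blocks p S)))"

definition is_Xi_map :: "(symfun \<Rightarrow> symfun) \<Rightarrow> bool" where
  "is_Xi_map \<phi> \<longleftrightarrow> Vector_Spaces.linear scale_symfun scale_symfun \<phi> \<and>
     (\<forall>p. int_partition p \<longrightarrow>
        \<phi> (Xi_symfun p) = (sgn_part p / fact (size p)) *\<^sub>s aug_monomial_symfun p)"

end

theory Submission
  imports Defs "HOL-Combinatorics.Permutations"
begin

text \<open>Write \<open>N\<^sub>q\<close> for the augmented monomial symmetric function of \<open>q\<close> divided by the factorial of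
  the number of parts. The \<open>N\<^sub>q\<close> are a basis of the symmetric functions, because each of them is
  a nonzero multiple of a monomial symmetric function. In this notation
  \<open>\<Xi>\<^sub>p = (\<Sum>S\<subseteq>E. N\<^bsub>\<pi>(S)\<^esub>)\<close>, where \<open>E\<close> is the edge set of \<open>D\<^sub>p\<close>.
  Let \<open>\<psi>\<close> be the linear map with \<open>\<psi>(N\<^sub>q) = sgn(q) \<Xi>\<^sub>q\<close>.

  The proof rests on \<open>\<psi>(\<Xi>\<^sub>p) = sgn(p) N\<^sub>p\<close>, which is Moebius inversion on the Boolean lattice of
  subsets of \<open>E\<close>. Deleting edges from a disjoint union of paths leaves a disjoint union of paths,
  so the spanning subgraph with edge set \<open>S\<close> is isomorphic to \<open>D\<^bsub>\<pi>(S)\<^esub>\<close>. This has two consequences.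
  Counting edges gives \<open>sgn(\<pi>(S)) = (-1)\<^bsup>|S|\<^esup>\<close>, and transporting subgraphs along the isomorphism
  gives \<open>\<Xi>\<^bsub>\<pi>(S)\<^esub> = (\<Sum>T\<subseteq>S. N\<^bsub>\<pi>(T)\<^esub>)\<close>. Hence
  \<open>\<psi>(\<Xi>\<^sub>p) = (\<Sum>S\<subseteq>E. (-1)\<^bsup>|S|\<^esup> (\<Sum>T\<subseteq>S. N\<^bsub>\<pi>(T)\<^esub>))\<close>. After exchanging the sums, the
  coefficient of \<open>N\<^bsub>\<pi>(T)\<^esub>\<close> is the alternating sum over all \<open>S\<close> between \<open>T\<close> and \<open>E\<close>, which
  vanishes unless \<open>T = E\<close>. What remains is \<open>(-1)\<^bsup>|E|\<^esup> N\<^sub>p = sgn(p) N\<^sub>p\<close>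
  (lemma \<open>signed_sum_Xi_symfun\<close>).

  So \<open>\<psi>\<close> has the values prescribed for the map in question, and since signs square to 1 it
  exchanges the two bases up to sign: \<open>\<psi> \<circ> \<psi>\<close> fixes every \<open>N\<^sub>q\<close>.
  Every linear map \<open>\<phi>\<close> with the prescribed values on the \<open>\<Xi>\<^sub>p\<close> satisfies \<open>\<phi> \<circ> \<psi> = id\<close> by the same
  computation, and therefore \<open>\<phi> = \<psi>\<close>.

  Graph isomorphisms are handled by storing a disjoint union of paths as the list of its paths,
  each a list of vertices. A spanning subgraph is then another way of cutting the same
  concatenated vertex list into pieces, and two such lists with equal path lengths differ only by
  a renaming of vertices.\<close>

section \<open>Disjoint unions of paths as lists of vertex lists\<close>

definition consecutive :: "'a list \<Rightarrow> ('a \<times> 'a) set" where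
  "consecutive xs = set (zip xs (tl xs))"

definition linked :: "'a list list \<Rightarrow> ('a \<times> 'a) set" where
  "linked xss = (\<Union>xs\<in>set xss. consecutive xs)"

definition components :: "'a set \<Rightarrow> ('a \<times> 'a) set \<Rightarrow> 'a set set" where
  "components V S = V // (S \<union> S\<inverse>)\<^sup>*"

lemma consecutive_simps [simp]:
  "consecutive [] = {}"
  "consecutive [x] = {}"
  "consecutive (x # y # zs) = insert (x, y) (consecutive (y # zs))"
  by (auto simp: consecutive_def)

lemma consecutive_conv_nth: "consecutive xs = {(xs ! i, xs ! Suc i) |i. Suc i < length xs}"
  unfolding consecutive_def set_zip by (rule Collect_cong) (auto simp: nth_tl less_diff_conv)

lemma linked_simps [simp]:
  "linked [] = {}"
  "linked (xs # xss) = consecutive xs \<union> linked xss"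
  "linked (xss @ yss) = linked xss \<union> linked yss"
  by (auto simp: linked_def)

lemma finite_linked [simp]: "finite (linked xss)"
  by (simp add: linked_def consecutive_def)

lemma consecutive_subset: "consecutive xs \<subseteq> set xs \<times> set xs"
  unfolding consecutive_def by (cases xs) (auto dest: set_zip_leftD set_zip_rightD)

lemma linked_subset: "linked xss \<subseteq> set (concat xss) \<times> set (concat xss)"
  using consecutive_subset unfolding linked_def by fastforce

lemma consecutive_map: "consecutive (map f xs) = map_prod f f ` consecutive xs"
  by (induction xs rule: induct_list012) auto

lemma linked_map: "linked (map (map f) xss) = map_prod f f ` linked xss"
  by (induction xss) (auto simp: consecutive_map image_Un)

lemma card_consecutive: "distinct xs \<Longrightarrow> card (consecutive xs) = length xs - 1"
  unfolding consecutive_def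
  by (subst distinct_card) (auto simp: distinct_zipI1)

lemma card_linked:
  assumes "distinct (concat xss)" "[] \<notin> set xss"
  shows "card (linked xss) + length xss = length (concat xss)"
  using assms
proof (induction xss)
  case (Cons xs xss)
  have "consecutive xs \<inter> linked xss = {}"
    using Cons.prems consecutive_subset[of xs] linked_subset[of xss] by fastforce
  hence "card (linked (xs # xss)) = card (consecutive xs) + card (linked xss)"
    by (simp add: card_Un_disjoint consecutive_def)
  moreover have "length xs > 0" using Cons.prems by auto
  ultimately show ?case
    using Cons by (cases xs) (auto simp: card_consecutive)
qed simp

text \<open>Scan the path from its end. If the first edge is deleted, the first vertex becomes a path
  of its own; if it is kept, the vertex is put in front of the first piece of the rest.\<close>

lemma cut_path:
  assumes "S \<subseteq> consecutive xs"
  obtains yss where "concat yss = xs" "[] \<notin> set yss" "linked yss = S"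
proof -
  have "\<exists>yss. concat yss = xs \<and> [] \<notin> set yss \<and> linked yss = S"
    using assms
  proof (induction xs arbitrary: S rule: induct_list012)
    case 1
    thus ?case by (intro exI[of _ "[]"]) simp
  next
    case (2 x)
    thus ?case by (intro exI[of _ "[[x]]"]) simp
  next
    case (3 x y zs)
    have "S - {(x, y)} \<subseteq> consecutive (y # zs)"
      using 3(3) by auto
    from 3(2)[OF this] obtain yss where
      yss: "concat yss = y # zs" "[] \<notin> set yss" "linked yss = S - {(x, y)}"
      by blast
    show ?case
    proof (cases "(x, y) \<in> S")
      case False
      with yss show ?thesis by (intro exI[of _ "[x] # yss"]) auto
    next
      case True
      obtain ys yss' where yss': "yss = (y # ys) # yss'"
        using yss(1,2) by (cases yss; cases "hd yss") auto
      with yss True show ?thesis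
        by (intro exI[of _ "(x # y # ys) # yss'"]) auto
    qed
  qed
  with that show ?thesis by blast
qed

lemma cut_paths:
  assumes "S \<subseteq> linked xss"
  obtains yss where "concat yss = concat xss" "[] \<notin> set yss" "linked yss = S"
proof -
  have "\<exists>yss. concat yss = concat xss \<and> [] \<notin> set yss \<and> linked yss = S"
    using assms
  proof (induction xss arbitrary: S)
    case Nil
    thus ?case by (intro exI[of _ "[]"]) simp
  next
    case (Cons xs xss)
    obtain yss where yss: "concat yss = xs" "[] \<notin> set yss" "linked yss = S \<inter> consecutive xs"
      using cut_path[of "S \<inter> consecutive xs" xs] by blast
    obtain zss where zss: "concat zss = concat xss" "[] \<notin> set zss" "linked zss = S \<inter> linked xss"
      using Cons.IH[of "S \<inter> linked xss"] by blast
    show ?case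
      using yss zss Cons.prems by (intro exI[of _ "yss @ zss"]) auto
  qed
  with that show ?thesis by blast
qed

text \<open>Both vertices are connected to the first vertex of the path.\<close>

lemma path_connected:
  assumes "x \<in> set xs" "y \<in> set xs"
  shows "(x, y) \<in> (consecutive xs \<union> (consecutive xs)\<inverse>)\<^sup>*"
proof -
  have hd: "(hd xs, x) \<in> (consecutive xs \<union> (consecutive xs)\<inverse>)\<^sup>*" if "x \<in> set xs" for x
    using that
  proof (induction xs rule: induct_list012)
    case (3 u v zs)
    show ?case
    proof (cases "x = u")
      case False
      hence "(v, x) \<in> (consecutive (v # zs) \<union> (consecutive (v # zs))\<inverse>)\<^sup>*"
        using 3 by simp
      hence "(v, x) \<in> (consecutive (u # v # zs) \<union> (consecutive (u # v # zs))\<inverse>)\<^sup>*"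
        by (rule rev_subsetD[OF _ rtrancl_mono]) auto
      thus ?thesis
        by (auto intro: converse_rtrancl_into_rtrancl)
    qed simp
  qed auto
  have "sym ((consecutive xs \<union> (consecutive xs)\<inverse>)\<^sup>*)"
    by (intro sym_rtrancl) (auto simp: sym_def)
  with hd[OF assms(1)] have "(x, hd xs) \<in> (consecutive xs \<union> (consecutive xs)\<inverse>)\<^sup>*"
    by (auto dest: symD)
  with hd[OF assms(2)] show ?thesis
    by (rule rtrancl_trans[rotated])
qed

text \<open>Along any edge one cannot leave a path, because paths with a common vertex are equal.\<close>

lemma component_of_path:
  assumes "distinct (concat yss)" "ys \<in> set yss" "x \<in> set ys"
  shows "(linked yss \<union> (linked yss)\<inverse>)\<^sup>* `` {x} = set ys"
proof (intro equalityI subsetI)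
  fix y assume "y \<in> set ys"
  have "(x, y) \<in> (consecutive ys \<union> (consecutive ys)\<inverse>)\<^sup>*"
    using path_connected assms(3) \<open>y \<in> set ys\<close> by fast
  moreover have "consecutive ys \<union> (consecutive ys)\<inverse> \<subseteq> linked yss \<union> (linked yss)\<inverse>"
    using assms(2) by (auto simp: linked_def)
  ultimately show "y \<in> (linked yss \<union> (linked yss)\<inverse>)\<^sup>* `` {x}"
    using rtrancl_mono by blast
next
  have disj: "zs = ys" if "zs \<in> set yss" "z \<in> set zs" "z \<in> set ys" for z zs
    using assms(1,2) that unfolding distinct_concat_iff by blast
  fix y assume "y \<in> (linked yss \<union> (linked yss)\<inverse>)\<^sup>* `` {x}"
  hence "(x, y) \<in> (linked yss \<union> (linked yss)\<inverse>)\<^sup>*" by simp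
  thus "y \<in> set ys"
  proof induction
    case (step u v)
    then obtain zs where "zs \<in> set yss" "(u, v) \<in> consecutive zs \<or> (v, u) \<in> consecutive zs"
      by (auto simp: linked_def)
    with step.IH disj consecutive_subset[of zs] show ?case by blast
  qed (use assms in auto)
qed

lemma components_linked:
  assumes "distinct (concat yss)" "[] \<notin> set yss"
  shows "components (set (concat yss)) (linked yss) = set ` set yss"
proof -
  have "components (set (concat yss)) (linked yss) =
      (\<Union>ys\<in>set yss. (\<lambda>x. (linked yss \<union> (linked yss)\<inverse>)\<^sup>* `` {x}) ` set ys)"
    by (auto simp: components_def quotient_def)
  also have "\<dots> = (\<Union>ys\<in>set yss. {set ys})"
  proof (intro SUP_cong refl)
    fix ys assume "ys \<in> set yss"
    moreover from this assms(2) have "set ys \<noteq> {}" by auto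
    ultimately show "(\<lambda>x. (linked yss \<union> (linked yss)\<inverse>)\<^sup>* `` {x}) ` set ys = {set ys}"
      using component_of_path[OF assms(1)]
      by (simp add: image_constant_conv cong: image_cong)
  qed
  finally show ?thesis by auto
qed

text \<open>Distinct nonempty paths have distinct vertex sets, so no component is counted twice when
  the multiset of components is formed.\<close>

lemma block_sizes_linked:
  assumes "distinct (concat yss)" "[] \<notin> set yss"
  shows "block_sizes (components (set (concat yss)) (linked yss)) = mset (map length yss)"
proof -
  have dist: "distinct yss" and dist': "\<And>ys. ys \<in> set yss \<Longrightarrow> distinct ys"
    and disj: "\<And>ys zs. ys \<in> set yss \<Longrightarrow> zs \<in> set yss \<Longrightarrow> ys \<noteq> zs \<Longrightarrow> set ys \<inter> set zs = {}"
    using assms by (auto simp: distinct_concat_iff)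
  have "inj_on set (set yss)"
    using disj assms(2) by (intro inj_onI) (metis inf.idem set_empty2)
  hence "mset_set (set ` set yss) = image_mset set (mset yss)"
    using dist by (simp add: image_mset_mset_set[symmetric] mset_set_set)
  moreover have "image_mset card (image_mset set (mset yss)) = image_mset length (mset yss)"
    using dist' by (auto simp: multiset.map_comp distinct_card intro!: image_mset_cong)
  ultimately show ?thesis
    using assms by (simp add: components_linked block_sizes_def del: set_concat)
qed

text \<open>Disjoint unions of paths with the same lengths are isomorphic: match the vertices in the
  order of the concatenated lists.\<close>

lemma relabel_paths:
  assumes "distinct (concat xss)" "map length xss = map length yss"
  obtains f where "yss = map (map f) xss"
proof -
  have len: "length (concat xss) = length (concat yss)"
    using assms(2) by (simp add: length_concat)
  define f where "f = the \<circ> map_of (zip (concat xss) (concat yss))"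
  \<comment> \<open>The concatenated lists agree, and they are cut into pieces of the same lengths.\<close>
  have "map f (concat xss) = concat yss"
    using assms(1) len
    by (intro nth_equalityI) (auto simp: f_def map_of_zip_nth)
  hence "concat (map (map f) xss) = concat yss"
    by (simp add: map_concat)
  moreover have "length xss = length yss"
    using assms(2) map_eq_imp_length_eq by blast
  moreover have "\<forall>(xs, ys)\<in>set (zip (map (map f) xss) yss). length xs = length ys"
    using assms(2) \<open>length xss = length yss\<close>
    by (auto simp: set_zip) (metis nth_map)
  ultimately have "map (map f) xss = yss"
    by (intro concat_injective) auto
  thus ?thesis using that by blast
qed

text \<open>Isomorphism invariance of the sum that defines \<open>\<Xi>\<close>. Cutting the list of paths on one side
  and renaming the pieces gives the corresponding subgraph on the other side, and the block sizes
  are the lengths of the pieces on both sides.\<close>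

lemma sum_subgraphs_eq_if_lengths_eq:
  fixes g :: "nat multiset \<Rightarrow> 'c::comm_monoid_add"
  assumes dist: "distinct (concat xss)" "distinct (concat yss)"
    and len: "map length xss = map length yss"
  shows "(\<Sum>S\<in>Pow (linked xss). g (block_sizes (components (set (concat xss)) S))) =
         (\<Sum>S\<in>Pow (linked yss). g (block_sizes (components (set (concat yss)) S)))"
proof -
  obtain f where yss: "yss = map (map f) xss"
    using relabel_paths[OF dist(1) len] .
  have concat_yss: "concat yss = map f (concat xss)"
    by (simp add: yss map_concat)
  hence inj: "inj_on f (set (concat xss))"
    using dist by (simp only: distinct_map)
  have inj': "inj_on (map_prod f f) (linked xss)"
    by (rule inj_on_subset[OF map_prod_inj_on[OF inj inj] linked_subset])
  have "block_sizes (components (set (concat yss)) (map_prod f f ` S)) =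
      block_sizes (components (set (concat xss)) S)" if S: "S \<subseteq> linked xss" for S
  proof -
    obtain zss where zss: "concat zss = concat xss" "[] \<notin> set zss" "linked zss = S"
      using cut_paths[OF S] .
    have zss': "concat (map (map f) zss) = concat yss"
      by (simp add: concat_yss zss(1)[symmetric] map_concat)
    have "block_sizes (components (set (concat (map (map f) zss))) (linked (map (map f) zss)))
        = mset (map length (map (map f) zss))"
      using zss dist(2) zss' by (intro block_sizes_linked) auto
    also have "map length (map (map f) zss) = map length zss"
      by simp
    also have "mset \<dots> = block_sizes (components (set (concat zss)) (linked zss))"
      using zss dist(1) by (intro block_sizes_linked[symmetric]) auto
    finally show ?thesis
      using zss zss' by (simp only: linked_map)
  qed
  moreover have "Pow (linked yss) = (`) (map_prod f f) ` Pow (linked xss)"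
    by (simp add: yss linked_map image_Pow_surj)
  moreover have "inj_on ((`) (map_prod f f)) (Pow (linked xss))"
    by (rule inj_on_image_Pow[OF inj'])
  ultimately show ?thesis
    by (simp add: sum.reindex)
qed

section \<open>The digraph of a partition and its spanning subgraphs\<close>

definition path_rows :: "nat multiset \<Rightarrow> (nat \<times> nat) list list" where
  "path_rows p = map (\<lambda>i. map (Pair i) [0..<parts p ! i]) [0..<length (parts p)]"

lemma map_length_path_rows: "map length (path_rows p) = parts p"
  by (simp add: path_rows_def comp_def map_nth)

lemma mset_parts [simp]: "mset (parts p) = p"
  by (simp add: parts_def)

lemma distinct_concat_path_rows: "distinct (concat (path_rows p))"
  unfolding path_rows_def distinct_concat_iff
proof (intro conjI allI impI)
  show "distinct (removeAll [] (map (\<lambda>i. map (Pair i) [0..<parts p ! i]) [0..<length (parts p)]))"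
    unfolding removeAll_filter_not_eq filter_map distinct_map
    by (auto simp: inj_on_def hd_map dest!: arg_cong[where f = "\<lambda>xs. fst (hd xs)"])
qed (auto simp: distinct_map inj_on_def)

lemma path_verts_eq: "path_verts p = set (concat (path_rows p))"
  by (auto simp: path_verts_def path_rows_def)

lemma consecutive_row: "consecutive (map (Pair i) [0..<n]) = {((i, j), (i, Suc j)) |j. Suc j < n}"
proof -
  have "consecutive (map (Pair i) [0..<n]) =
      (\<lambda>j. (map (Pair i) [0..<n] ! j, map (Pair i) [0..<n] ! Suc j)) ` {j. Suc j < n}"
    by (simp only: consecutive_conv_nth setcompr_eq_image length_map length_upt diff_zero)
  also have "\<dots> = (\<lambda>j. ((i, j), (i, Suc j))) ` {j. Suc j < n}"
    by (intro image_cong) auto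
  finally show ?thesis by auto
qed

lemma path_edges_eq: "path_edges p = linked (path_rows p)"
  by (auto simp: path_edges_def path_rows_def linked_def consecutive_row)

lemma card_path_edges:
  assumes "int_partition p"
  shows "card (path_edges p) = sum_mset p - size p"
proof -
  have len: "mset (map length (path_rows p)) = p"
    by (simp only: map_length_path_rows mset_parts)
  have "card (path_edges p) + length (path_rows p) = length (concat (path_rows p))"
    unfolding path_edges_eq
    using assms by (intro card_linked distinct_concat_path_rows)
      (metis len int_partition_def image_eqI length_0_conv set_map set_mset_mset)
  moreover have "length (path_rows p) = size p"
    by (metis len length_map size_mset)
  moreover have "length (concat (path_rows p)) = sum_mset p"
    by (metis len length_concat sum_mset_sum_list)
  ultimately show ?thesis by simp
qed

definition normalized_monomial :: "nat multiset \<Rightarrow> symfun" where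
  "normalized_monomial q = (1 / fact (size q)) *\<^sub>s aug_monomial_symfun q"

text \<open>In the definition of \<open>\<Xi>\<close> the digraph \<open>D\<^sub>p\<close> can be replaced by any disjoint union of paths whose
  lengths are the parts of \<open>p\<close>, in any order. This is needed for the subgraphs of \<open>D\<^sub>p\<close>, whose
  paths come in no particular order of length.\<close>

lemma Xi_symfun_linked:
  assumes dist: "distinct (concat yss)"
  shows "Xi_symfun (mset (map length yss)) =
    (\<Sum>S\<in>Pow (linked yss). normalized_monomial (block_sizes (components (set (concat yss)) S)))"
proof -
  let ?p = "mset (map length yss)"
  \<comment> \<open>Sorting the paths by length does not change the graph and gives the lengths the order
    of the parts of \<open>?p\<close>.\<close>
  let ?zss = "rev (sort_key length yss)"
  have "sort (map length yss) = map length (sort_key length yss)"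
    by (intro properties_for_sort) simp_all
  hence len: "map length (path_rows ?p) = map length ?zss"
    by (simp add: map_length_path_rows parts_def rev_map del: mset_map)
  have [simp]: "linked ?zss = linked yss" "set (concat ?zss) = set (concat yss)"
    by (auto simp: linked_def)
  have "mset (concat (sort_key length yss)) = mset (concat yss)"
    unfolding mset_concat sum_mset_sum_list[symmetric] mset_map mset_sort ..
  hence dist': "distinct (concat ?zss)"
    using dist mset_eq_imp_distinct_iff by auto
  have "Xi_symfun ?p = (\<Sum>S\<in>Pow (linked (path_rows ?p)).
      normalized_monomial (block_sizes (components (set (concat (path_rows ?p))) S)))"
    by (simp add: Xi_symfun_def path_edges_eq normalized_monomial_def path_blocks_def
        components_def path_verts_eq block_sizes_def)
  also have "\<dots> = (\<Sum>S\<in>Pow (linked ?zss).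
      normalized_monomial (block_sizes (components (set (concat ?zss)) S)))"
    using len by (intro sum_subgraphs_eq_if_lengths_eq distinct_concat_path_rows dist')
  finally show ?thesis
    by (simp only: \<open>linked ?zss = linked yss\<close> \<open>set (concat ?zss) = set (concat yss)\<close>)
qed

text \<open>A spanning subgraph of \<open>D\<^sub>p\<close> is again a disjoint union of paths, with the block sizes as
  lengths. The properties of \<open>D\<^bsub>\<pi>(S)\<^esub>\<close> that matter can be read off from the list \<open>yss\<close>.\<close>

lemma path_subforest:
  assumes "S \<subseteq> path_edges p"
  obtains yss where "distinct (concat yss)" "set (concat yss) = path_verts p" "[] \<notin> set yss"
    "linked yss = S" "block_sizes (path_blocks p S) = mset (map length yss)"
proof -
  obtain yss where yss: "concat yss = concat (path_rows p)" "[] \<notin> set yss" "linked yss = S"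
    using cut_paths[OF assms[unfolded path_edges_eq]] .
  have dist: "distinct (concat yss)"
    using yss(1) distinct_concat_path_rows by simp
  have verts: "set (concat yss) = path_verts p"
    by (simp only: yss(1) path_verts_eq)
  have "block_sizes (path_blocks p S) = mset (map length yss)"
    using block_sizes_linked[OF dist yss(2)]
    by (simp only: verts yss(3) path_blocks_def components_def)
  with that dist verts yss(2,3) show ?thesis by blast
qed

section \<open>Moebius inversion over the edge sets\<close>

lemma alternating_sum_supersets:
  assumes "finite E" "T \<subseteq> E"
  shows "(\<Sum>S | S \<subseteq> E \<and> T \<subseteq> S. (- 1) ^ card S) = (if T = E then (- 1) ^ card E else (0 :: rat))"
proof (cases "T = E")
  case True
  hence "{S. S \<subseteq> E \<and> T \<subseteq> S} = {E}" by auto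
  with True show ?thesis by simp
next
  case False
  with assms have "T \<subset> E" by auto
  with assms(1) have "(\<Sum>S | S \<subseteq> E \<and> T \<subseteq> S. (- 1) ^ card S) = (0 :: rat)"
    by (intro sum_alternating_cancels) (auto intro: finite_subset[of _ "Pow E"]
        simp: card_subsupersets_even_odd conj_assoc)
  with False show ?thesis by simp
qed

text \<open>The left-hand side is the image of \<open>\<Xi>\<^sub>p\<close> under the linear map that sends \<open>N\<^sub>q\<close> to
  \<open>sgn(q) \<Xi>\<^sub>q\<close>. Every \<open>\<Xi>\<^bsub>\<pi>(S)\<^esub>\<close> is expanded over the subsets of \<open>S\<close>, and the signs cancel except for
  the full edge set.\<close>

lemma signed_sum_Xi_symfun:
  assumes p: "int_partition p"
  shows "(\<Sum>S\<in>Pow (path_edges p).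
      sgn_part (block_sizes (path_blocks p S)) *\<^sub>s Xi_symfun (block_sizes (path_blocks p S))) =
    sgn_part p *\<^sub>s normalized_monomial p"
proof -
  let ?E = "path_edges p"
  let ?q = "\<lambda>S. block_sizes (path_blocks p S)"
  let ?N = "\<lambda>S. normalized_monomial (?q S)"
  have q: "sgn_part (?q S) = (- 1) ^ card S \<and> Xi_symfun (?q S) = (\<Sum>T\<in>Pow S. ?N T)"
    if S: "S \<subseteq> ?E" for S
  proof -
    obtain yss where dist: "distinct (concat yss)" and verts: "set (concat yss) = path_verts p"
      and ne: "[] \<notin> set yss" and edges: "linked yss = S" and qS: "?q S = mset (map length yss)"
      using path_subforest[OF S] .
    have "card S + size (?q S) = sum_mset (?q S)"
      using card_linked[OF dist ne] edges
      by (simp only: qS size_mset length_map sum_mset_sum_list length_concat)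
    hence "sgn_part (?q S) = (- 1) ^ card S"
      unfolding sgn_part_def by (metis add_diff_cancel_right')
    moreover have "Xi_symfun (?q S) = (\<Sum>T\<in>Pow S. ?N T)"
      unfolding qS Xi_symfun_linked[OF dist]
      by (simp only: verts edges path_blocks_def components_def)
    ultimately show ?thesis ..
  qed
  have fin: "finite ?E" by (rule finite_path_edges)
  \<comment> \<open>As the parts are positive, every path has a vertex and so is a block.\<close>
  have full: "?q ?E = p"
  proof -
    have "[] \<notin> set (path_rows p)"
      using p map_length_path_rows[of p]
      by (metis mset_parts int_partition_def image_eqI length_0_conv set_map set_mset_mset)
    from block_sizes_linked[OF distinct_concat_path_rows this] show ?thesis
      by (simp add: path_blocks_def components_def path_verts_eq path_edges_eq
          map_length_path_rows mset_parts del: set_concat mset_map)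
  qed
  have "(\<Sum>S\<in>Pow ?E. sgn_part (?q S) *\<^sub>s Xi_symfun (?q S)) =
      (\<Sum>S\<in>Pow ?E. \<Sum>T\<in>{T\<in>Pow ?E. T \<subseteq> S}. (- 1) ^ card S *\<^sub>s ?N T)"
    by (intro sum.cong refl) (auto simp: q symfun.scale_sum_right intro!: sum.cong)
  also have "\<dots> = (\<Sum>T\<in>Pow ?E. \<Sum>S\<in>{S\<in>Pow ?E. T \<subseteq> S}. (- 1) ^ card S *\<^sub>s ?N T)"
    using fin by (intro sum.swap_restrict) auto
  also have "\<dots> = (\<Sum>T\<in>Pow ?E. if T = ?E then (- 1) ^ card ?E *\<^sub>s ?N ?E else 0)"
    using alternating_sum_supersets[OF fin]
    by (intro sum.cong refl) (auto simp: symfun.scale_sum_left[symmetric])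
  also have "\<dots> = (- 1) ^ card ?E *\<^sub>s ?N ?E"
    using fin by simp
  also have "\<dots> = sgn_part p *\<^sub>s normalized_monomial p"
    using card_path_edges[OF p] by (simp add: full sgn_part_def)
  finally show ?thesis .
qed

lemma int_partition_path_blocks:
  assumes "S \<subseteq> path_edges p"
  shows "int_partition (block_sizes (path_blocks p S))"
proof (rule path_subforest[OF assms])
  fix yss :: "(nat \<times> nat) list list"
  assume "[] \<notin> set yss" "block_sizes (path_blocks p S) = mset (map length yss)"
  thus ?thesis
    by (auto simp: int_partition_def)
qed

section \<open>The basis of normalized monomial symmetric functions\<close>

lemma coeff_of_sum: "coeff_of (sum f A) a = (\<Sum>x\<in>A. coeff_of (f x) a)"
  by (induction A rule: infinite_finite_induct) (simp_all add: zero_symfun.rep_eq plus_symfun.rep_eq)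

lemma int_partition_exponents: "int_partition (exponents a)"
  by (auto simp: int_partition_def exponents_def)

lemma ex_exponents:
  assumes "int_partition q"
  obtains a where "exponents a = q"
proof -
  obtain xs where xs: "mset xs = q"
    using ex_mset by blast
  have "xs ! i \<noteq> 0" if "i < length xs" for i
    using that assms xs unfolding int_partition_def by (metis nth_mem set_mset_mset)
  hence keys: "Poly_Mapping.keys (Poly_Mapping.nth xs) = {0..<length xs}"
    by (auto simp: in_keys_iff Poly_Mapping.nth.rep_eq nth_default_def
        simp del: keys_nth split: if_splits)
  have "exponents (Poly_Mapping.nth xs) = image_mset (nth xs) (mset_set {0..<length xs})"
    unfolding exponents_def keys
    by (intro image_mset_cong) (auto simp: Poly_Mapping.nth.rep_eq nth_default_def)
  also have "\<dots> = mset (map (nth xs) [0..<length xs])"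
    by (simp only: mset_map mset_upt)
  finally show ?thesis
    using that xs by (simp add: map_nth)
qed

text \<open>Monomials with the same multiset of nonzero exponents are permutations of each other. To get
  a permutation of all variables, both exponent vectors are compared on the union \<open>?K\<close> of their
  supports, where the values that are added are zeros, equally many for both.\<close>

lemma coeff_of_cong:
  assumes "exponents a = exponents b"
  shows "coeff_of f a = coeff_of f b"
proof -
  let ?K = "Poly_Mapping.keys a \<union> Poly_Mapping.keys b"
  have pad: "image_mset (Poly_Mapping.lookup c) (mset_set ?K) =
      exponents c + replicate_mset (card ?K - size (exponents c)) 0"
    if "Poly_Mapping.keys c \<subseteq> ?K" for c :: "nat \<Rightarrow>\<^sub>0 nat"
  proof -
    have "mset_set ?K = mset_set (Poly_Mapping.keys c) + mset_set (?K - Poly_Mapping.keys c)"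
      using that by (subst mset_set_Union[symmetric]) (auto simp: Un_absorb1)
    moreover have "image_mset (Poly_Mapping.lookup c) (mset_set (?K - Poly_Mapping.keys c)) =
        image_mset (\<lambda>_. 0) (mset_set (?K - Poly_Mapping.keys c))"
      by (intro image_mset_cong) (auto simp: in_keys_iff)
    moreover have "\<dots> = replicate_mset (card ?K - size (exponents c)) 0"
      using that by (simp add: image_mset_const_eq card_Diff_subset exponents_def)
    ultimately show ?thesis by (simp add: exponents_def)
  qed
  have "image_mset (Poly_Mapping.lookup b) (mset_set ?K) =
      image_mset (Poly_Mapping.lookup a) (mset_set ?K)"
    using pad[of a] pad[of b] assms by simp
  then obtain \<sigma> where \<sigma>: "\<sigma> permutes ?K"
    and eq: "\<forall>i\<in>?K. Poly_Mapping.lookup b i = Poly_Mapping.lookup a (\<sigma> i)"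
    using image_mset_eq_implies_permutes[of ?K "Poly_Mapping.lookup b" "Poly_Mapping.lookup a"]
    by auto
  have "Poly_Mapping.lookup b i = Poly_Mapping.lookup a (\<sigma> i)" for i
  proof (cases "i \<in> ?K")
    case False
    with \<sigma> have "\<sigma> i = i" by (rule permutes_not_in)
    with False show ?thesis by (simp add: in_keys_iff)
  qed (use eq in blast)
  moreover have bij: "bij \<sigma>" using \<sigma> by (rule permutes_bij)
  ultimately have "Poly_Mapping.map_key \<sigma> a = b"
    by (intro poly_mapping_eqI) (simp add: map_key.rep_eq bij_is_inj)
  moreover have "coeff_of f (Poly_Mapping.map_key \<sigma> a) = coeff_of f a"
    using coeff_of[of f] bij by (simp add: symmetric_coeffs_def)
  ultimately show ?thesis by simp
qed

definition norm_const :: "nat multiset \<Rightarrow> rat" where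
  "norm_const q = (\<Prod>i\<in>set_mset q. fact (count q i)) / fact (size q)"

lemma coeff_of_normalized_monomial:
  "coeff_of (normalized_monomial q) a = (if exponents a = q then norm_const q else 0)"
  by (simp add: normalized_monomial_def aug_monomial_symfun_def scale_symfun.rep_eq
      monomial_symfun.rep_eq norm_const_def)

lemma norm_const_nonzero: "norm_const q \<noteq> 0"
  by (simp add: norm_const_def)

lemma inj_on_normalized_monomial: "inj_on normalized_monomial {q. int_partition q}"
proof (intro inj_onI)
  fix q q' assume "q \<in> {q. int_partition q}" and eq: "normalized_monomial q = normalized_monomial q'"
  then obtain a where "exponents a = q" using ex_exponents by blast
  moreover have "coeff_of (normalized_monomial q) a = coeff_of (normalized_monomial q') a"
    by (simp only: eq)
  ultimately show "q = q'"
    using norm_const_nonzero[of q] by (simp add: coeff_of_normalized_monomial split: if_splits)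
qed

text \<open>A monomial with exponents \<open>q\<close> occurs in \<open>N\<^sub>q\<close> and in no other basis element, so its
  coefficient isolates the scalar of \<open>N\<^sub>q\<close>.\<close>

lemma independent_normalized_monomials:
  "symfun.independent (normalized_monomial ` {q. int_partition q})"
  unfolding symfun.independent_explicit_finite_subsets
proof (intro allI impI ballI)
  fix S u v
  assume S: "S \<subseteq> normalized_monomial ` {q. int_partition q}" "finite S"
    and sum: "(\<Sum>v\<in>S. u v *\<^sub>s v) = 0" and v: "v \<in> S"
  then obtain q where q: "v = normalized_monomial q" "int_partition q" by blast
  obtain a where a: "exponents a = q" using ex_exponents[OF q(2)] .
  have "0 = (\<Sum>w\<in>S. u w * coeff_of w a)"
    using arg_cong[OF sum, of "\<lambda>f. coeff_of f a"]
    by (simp add: coeff_of_sum scale_symfun.rep_eq zero_symfun.rep_eq)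
  also have "\<dots> = (\<Sum>w\<in>S. if w = v then u v * norm_const q else 0)"
  proof (intro sum.cong refl)
    fix w assume "w \<in> S"
    then obtain q' where q': "w = normalized_monomial q'" "int_partition q'" using S(1) by blast
    hence "w = v \<longleftrightarrow> q' = q"
      using q inj_on_normalized_monomial by (auto dest: inj_onD)
    thus "u w * coeff_of w a = (if w = v then u v * norm_const q else 0)"
      using q' a by (auto simp: coeff_of_normalized_monomial)
  qed
  also have "\<dots> = u v * norm_const q"
    using S(2) v by simp
  finally show "u v = 0"
    using norm_const_nonzero[of q] by simp
qed

text \<open>Symmetric functions have bounded degree, so this makes their expansions into the \<open>N\<^sub>q\<close>
  finite sums.\<close>

lemma finite_partitions_upto: "finite {q. int_partition q \<and> sum_mset q \<le> d}"
proof (rule finite_subset)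
  show "finite (mset ` {xs. set xs \<subseteq> {..d} \<and> length xs \<le> d})"
    by (intro finite_imageI finite_lists_length_le) simp
  show "{q. int_partition q \<and> sum_mset q \<le> d} \<subseteq> mset ` {xs. set xs \<subseteq> {..d} \<and> length xs \<le> d}"
  proof safe
    fix q assume q: "int_partition q" "sum_mset q \<le> d"
    have "size q \<le> sum_mset q"
      using q(1) by (induction q) (auto simp: int_partition_def)
    moreover have "x \<le> sum_mset q" if "x \<in># q" for x
      using multi_member_split[OF that] by auto
    ultimately have bounds: "size q \<le> d" "set_mset q \<subseteq> {..d}"
      using q(2) by (auto intro: order_trans)
    obtain xs where "mset xs = q" using ex_mset by blast
    with bounds show "q \<in> mset ` {xs. set xs \<subseteq> {..d} \<and> length xs \<le> d}"
      by (intro image_eqI[of _ _ xs]) auto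
  qed
qed

lemma span_normalized_monomials:
  "symfun.span (normalized_monomial ` {q. int_partition q}) = UNIV"
proof (intro equalityI subsetI UNIV_I)
  fix f :: symfun
  obtain d where d: "\<And>a. coeff_of f a \<noteq> 0 \<Longrightarrow> mon_degree a \<le> d"
    using coeff_of[of f] by (auto simp: bounded_degree_def)
  let ?Q = "{q. int_partition q \<and> sum_mset q \<le> d}"
  \<comment> \<open>By symmetry the coefficient is the same for every choice of a monomial with exponents \<open>q\<close>.\<close>
  define c where "c q = coeff_of f (SOME a. exponents a = q) / norm_const q" for q
  have "coeff_of f a = coeff_of (\<Sum>q\<in>?Q. c q *\<^sub>s normalized_monomial q) a" for a
  proof -
    have some: "coeff_of f (SOME b. exponents b = exponents a) = coeff_of f a"
      by (rule coeff_of_cong) (rule someI_ex, blast)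
    have "coeff_of (\<Sum>q\<in>?Q. c q *\<^sub>s normalized_monomial q) a =
        (\<Sum>q\<in>?Q. if q = exponents a then c q * norm_const q else 0)"
      by (auto simp: coeff_of_sum scale_symfun.rep_eq coeff_of_normalized_monomial intro!: sum.cong)
    also have "\<dots> = (if exponents a \<in> ?Q then coeff_of f a else 0)"
      using finite_partitions_upto[of d]
      by (simp add: c_def some norm_const_nonzero)
    also have "\<dots> = coeff_of f a"
      using d[of a] int_partition_exponents[of a] by (auto simp: sum_mset_exponents)
    finally show ?thesis ..
  qed
  hence "f = (\<Sum>q\<in>?Q. c q *\<^sub>s normalized_monomial q)"
    by (simp add: coeff_of_inject[symmetric] fun_eq_iff)
  also have "\<dots> \<in> symfun.span (normalized_monomial ` {q. int_partition q})"
    by (intro symfun.span_sum symfun.span_scale symfun.span_base) auto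
  finally show "f \<in> symfun.span (normalized_monomial ` {q. int_partition q})" .
qed

section \<open>The involution\<close>

lemma symfun_pair: "vector_space_pair scale_symfun scale_symfun"
  by unfold_locales

lemma linear_eq_on_normalized_monomials:
  assumes "Vector_Spaces.linear scale_symfun scale_symfun \<phi>"
    and "Vector_Spaces.linear scale_symfun scale_symfun \<psi>"
    and "\<And>q. int_partition q \<Longrightarrow> \<phi> (normalized_monomial q) = \<psi> (normalized_monomial q)"
  shows "\<phi> = \<psi>"
proof
  fix f
  show "\<phi> f = \<psi> f"
    using assms(3)
    by (intro vector_space_pair.linear_eq_on[OF symfun_pair assms(1,2), of f
          "normalized_monomial ` {q. int_partition q}"])
      (auto simp: span_normalized_monomials)
qed

lemma sgn_part_square: "sgn_part p * sgn_part p = 1"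
  by (simp add: sgn_part_def flip: power_mult_distrib)

text \<open>The second claim is the inversion formula; with it, applying \<open>\<psi>\<close> twice to \<open>N\<^sub>q\<close> multiplies
  by the square of a sign.\<close>

lemma signed_Xi_involution:
  assumes lin: "Vector_Spaces.linear scale_symfun scale_symfun \<psi>"
    and \<psi>: "\<And>q. int_partition q \<Longrightarrow> \<psi> (normalized_monomial q) = sgn_part q *\<^sub>s Xi_symfun q"
  shows "\<psi> \<circ> \<psi> = id"
    and "\<And>p. int_partition p \<Longrightarrow> \<psi> (Xi_symfun p) = sgn_part p *\<^sub>s normalized_monomial p"
proof -
  interpret Vector_Spaces.linear scale_symfun scale_symfun \<psi> by (rule lin)
  show Xi: "\<psi> (Xi_symfun p) = sgn_part p *\<^sub>s normalized_monomial p" if "int_partition p" for p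
  proof -
    have "Xi_symfun p = (\<Sum>S\<in>Pow (path_edges p). normalized_monomial (block_sizes (path_blocks p S)))"
      by (simp add: Xi_symfun_def normalized_monomial_def block_sizes_def)
    thus ?thesis
      unfolding signed_sum_Xi_symfun[OF that, symmetric]
      by (auto simp: sum \<psi> int_partition_path_blocks intro!: sum.cong)
  qed
  show "\<psi> \<circ> \<psi> = id"
  proof (rule linear_eq_on_normalized_monomials)
    show "Vector_Spaces.linear scale_symfun scale_symfun (\<psi> \<circ> \<psi>)"
      using lin lin by (rule Vector_Spaces.linear_compose)
    show "Vector_Spaces.linear scale_symfun scale_symfun id"
      by (rule symfun.linear_id)
  qed (simp add: \<psi> scale Xi sgn_part_square)
qed

theorem theorem3:
  "(\<exists>!\<phi>. is_Xi_map \<phi>) \<and> (\<forall>\<phi>. is_Xi_map \<phi> \<longrightarrow> \<phi> \<circ> \<phi> = id)"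
proof -
  let ?inv = "the_inv_into {q. int_partition q} normalized_monomial"
  obtain \<psi> where lin: "Vector_Spaces.linear scale_symfun scale_symfun \<psi>"
    and "\<forall>b\<in>normalized_monomial ` {q. int_partition q}.
      \<psi> b = sgn_part (?inv b) *\<^sub>s Xi_symfun (?inv b)"
    using vector_space_pair.linear_independent_extend[OF symfun_pair
        independent_normalized_monomials, of "\<lambda>b. sgn_part (?inv b) *\<^sub>s Xi_symfun (?inv b)"] by auto
  hence \<psi>: "\<psi> (normalized_monomial q) = sgn_part q *\<^sub>s Xi_symfun q" if "int_partition q" for q
    using that by (simp add: the_inv_into_f_f[OF inj_on_normalized_monomial])
  note inv = signed_Xi_involution(1)[OF lin \<psi>] and Xi = signed_Xi_involution(2)[OF lin \<psi>]
  have target: "(sgn_part p / fact (size p)) *\<^sub>s aug_monomial_symfun p =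
      sgn_part p *\<^sub>s normalized_monomial p" for p
    by (simp add: normalized_monomial_def)
  have "is_Xi_map \<psi>"
    using lin Xi by (simp add: is_Xi_map_def target)
  moreover have uniq: "\<phi> = \<psi>" if "is_Xi_map \<phi>" for \<phi>
  proof -
    have lin': "Vector_Spaces.linear scale_symfun scale_symfun \<phi>"
      and \<phi>: "\<And>p. int_partition p \<Longrightarrow> \<phi> (Xi_symfun p) = sgn_part p *\<^sub>s normalized_monomial p"
      using that by (auto simp: is_Xi_map_def target)
    interpret \<phi>: Vector_Spaces.linear scale_symfun scale_symfun \<phi> by (rule lin')
    \<comment> \<open>A left inverse of the involution \<open>\<psi>\<close> is \<open>\<psi>\<close> itself.\<close>
    have "\<phi> \<circ> \<psi> = id"
    proof (rule linear_eq_on_normalized_monomials)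
      show "Vector_Spaces.linear scale_symfun scale_symfun (\<phi> \<circ> \<psi>)"
        using lin lin' by (rule Vector_Spaces.linear_compose)
      show "Vector_Spaces.linear scale_symfun scale_symfun id"
        by (rule symfun.linear_id)
    qed (simp add: \<psi> \<phi> \<phi>.scale sgn_part_square)
    hence "(\<phi> \<circ> \<psi>) \<circ> \<psi> = id \<circ> \<psi>" by simp
    with inv show ?thesis by (simp add: comp_assoc)
  qed
  ultimately show ?thesis
    using inv uniq by blast
qed

end
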